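(* For any even $m\geq 2$, the subgraph $H_m$ of $G_m^{M}$ consisting of all arcs that correspond to centered flips has no edges between any two of the classes $\mathcal{M}^+_{m,c}$, $c=0,1,\dots,m-2$. Consequently $H_m$ has at least one connected component within each class $\mathcal{M}^+_{m,c}$, and in total at least $m-1$ connected components.
   Context: Let $n=2m$ points be equally spaced on a unit circle centered at the origin, labeled clockwise $1,\dots,n$. $\mathcal{M}_m$ is the set of non-crossing perfect matchings on these points. $G_m^{M}$ is the directed graph on $\mathcal{M}_m$ with an arc $(M,M')$ whenever $M'$ arises from $M$ by replacing two edges $\{a,b\},\{c,d\}\in M$ by $\{a,c\},\{b,d\}$ (a flip). The length $\ell(e)$ of an edge $e=\{i,j\}$ with $j-i$ odd is the minimum over the two sides of $e$ of (number of points strictly on that side)$/2$. A flip is centered if the four edges involved (two removed, two added), which form a convex quadrilateral, have lengths summing to $m-2$. $H_m$ has vertex set $\mathcal{M}_m$ and only the arcs of centered flips. For an edge $e$ with endpoints $i,j$ named so that the origin lies to the right of the ray from $i$ to $j$, $\mathrm{sgn}(e)=+1$ if $i$ is odd and $-1$ if $i$ is even; the weight is $w(M)=\sum_{e\in M}\mathrm{sgn}(e)\ell(e)$. $\mathcal{M}_{m,c}$ is the set of matchings of weight exactly $c$, and $\mathcal{M}^+_{m,c}:=\mathcal{M}_{m,c}\cup\mathcal{M}_{m,c-(m-2)}$ for $c=0,1,\dots,m-2$.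
   Formalization: The classes for c=0 and c=m-2 share the weight-0 matchings, and for m≥4 centered flips join these to weight m-2; so "no edges between classes" is read as: no arc from one class minus the other to the other minus the one, and every component lies inside a single class. *)

theory Defs
  imports "HOL-Analysis.Analysis" "HOL-Library.Disjoint_Sets" "Graph_Theory.Digraph_Component"
begin

text \<open>The negative argument makes the labelling run clockwise.\<close>

definition pt :: "nat \<Rightarrow> nat \<Rightarrow> complex" where
  "pt m k = cis (- (2 * pi * real k / real (2 * m)))"

text \<open>\<open>x\<close> lies strictly to the right of the line through \<open>a\<close> and \<open>b\<close>, oriented
  from \<open>a\<close> to \<open>b\<close>: the cross product of \<open>b - a\<close> and \<open>x - a\<close> is negative.\<close>

definition right_of :: "complex \<Rightarrow> complex \<Rightarrow> complex \<Rightarrow> bool" where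
  "right_of a b x \<longleftrightarrow> Im (cnj (b - a) * (x - a)) < 0"

definition chord :: "nat \<Rightarrow> nat set \<Rightarrow> complex set" where
  "chord m e = convex hull (pt m ` e)"

definition perfect_matching :: "nat \<Rightarrow> nat set set \<Rightarrow> bool" where
  "perfect_matching m M \<longleftrightarrow> partition_on {1..2 * m} M \<and> (\<forall>e\<in>M. card e = 2)"

definition matchings :: "nat \<Rightarrow> nat set set set" where
  "matchings m = {M. perfect_matching m M \<and>
     (\<forall>e\<in>M. \<forall>f\<in>M. e \<noteq> f \<longrightarrow> chord m e \<inter> chord m f = {})}"

definition right_count :: "nat \<Rightarrow> nat \<Rightarrow> nat \<Rightarrow> nat" where
  "right_count m i j = card {k \<in> {1..2 * m}. right_of (pt m i) (pt m j) (pt m k)}"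

text \<open>The two sides of \<open>e = {i, j}\<close> are the right-hand sides of its two orientations.
  Every edge of a non-crossing perfect matching has an even number of points on either side,
  so \<open>div\<close> is exact there.\<close>

definition edge_length :: "nat \<Rightarrow> nat set \<Rightarrow> nat" where
  "edge_length m e = min (right_count m (Min e) (Max e) div 2) (right_count m (Max e) (Min e) div 2)"

text \<open>The endpoint \<open>i\<close> is unique as long as \<open>e\<close> is not a diameter. For even \<open>m\<close> no edge
  of a non-crossing perfect matching is one, as its endpoints differ in parity.\<close>

definition edge_sign :: "nat \<Rightarrow> nat set \<Rightarrow> int" where
  "edge_sign m e =
     (if odd (THE i. \<exists>j. e = {i, j} \<and> right_of (pt m i) (pt m j) 0) then 1 else - 1)"

definition weight :: "nat \<Rightarrow> nat set set \<Rightarrow> int" where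
  "weight m M = (\<Sum>e\<in>M. edge_sign m e * int (edge_length m e))"

definition flips_to ::
  "nat set set \<Rightarrow> nat \<Rightarrow> nat \<Rightarrow> nat \<Rightarrow> nat \<Rightarrow> nat set set \<Rightarrow> bool" where
  "flips_to M a b c d M' \<longleftrightarrow> {a, b} \<in> M \<and> {c, d} \<in> M \<and> {a, b} \<noteq> {c, d} \<and>
     M' = (M - {{a, b}, {c, d}}) \<union> {{a, c}, {b, d}}"

definition centered :: "nat \<Rightarrow> nat \<Rightarrow> nat \<Rightarrow> nat \<Rightarrow> nat \<Rightarrow> bool" where
  "centered m a b c d \<longleftrightarrow>
     edge_length m {a, b} + edge_length m {c, d} + edge_length m {a, c} + edge_length m {b, d}
       = m - 2"

text \<open>Since both ends of an arc are non-crossing, the four edges of a flip automatically bound a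
  convex quadrilateral.\<close>

definition flip_graph :: "nat \<Rightarrow> nat set set pair_pre_digraph" where
  "flip_graph m = \<lparr> pverts = matchings m,
     parcs = {(M, M'). M \<in> matchings m \<and> M' \<in> matchings m \<and> (\<exists>a b c d. flips_to M a b c d M')} \<rparr>"

definition centered_flip_graph :: "nat \<Rightarrow> nat set set pair_pre_digraph" where
  "centered_flip_graph m = \<lparr> pverts = pverts (flip_graph m),
     parcs = {(M, M') \<in> parcs (flip_graph m).
                \<exists>a b c d. flips_to M a b c d M' \<and> centered m a b c d} \<rparr>"

text \<open>Vertex sets of the connected components of the underlying undirected graph.\<close>

definition components_verts :: "'a pair_pre_digraph \<Rightarrow> 'a set set" where
  "components_verts G = pre_digraph.sccs_verts (with_proj (mk_symmetric (with_proj G)))"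

definition weight_class :: "nat \<Rightarrow> int \<Rightarrow> nat set set set" where
  "weight_class m c = {M \<in> matchings m. weight m M = c}"

text \<open>The classes for \<open>c = 0\<close> and \<open>c = m - 2\<close> share the matchings of weight \<open>0\<close>;
  for \<open>m > 2\<close> all other pairs of classes with \<open>0 \<le> c \<le> m - 2\<close> are disjoint.\<close>

definition weight_class_plus :: "nat \<Rightarrow> int \<Rightarrow> nat set set set" where
  "weight_class_plus m c = weight_class m c \<union> weight_class m (c - (int m - 2))"

end

theory Submission
  imports Defs
begin

text \<open>
  Read an edge as an interval of \<open>{1..2m}\<close> and call it long if it spans more than \<open>m\<close>. Let \<open>E\<close> be
  the number of edges starting at an even point and \<open>T\<close> the number of long edges starting at an odd
  point minus the number of those starting at an even point. Counting nested pairs of edges gives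
  \<open>w(M) = E - (m - 1) T\<close>. The long edges are the ones enclosing a shortest long edge, and their
  starting points alternate in parity from 1 on, so \<open>T\<close> is 0 or 1. A centered flip exchanges
  \<open>{p, q}, {r, s}\<close> and \<open>{p, s}, {q, r}\<close> for some \<open>p < q < r < s\<close>, of which only \<open>{p, s}\<close> is long,
  and therefore preserves \<open>E - T = w(M) + (m - 2) T\<close>. This invariant takes exactly the values
  \<open>0, \<dots>, m - 2\<close>, and its value \<open>c\<close> forces the weight to be \<open>c\<close> or \<open>c - (m - 2)\<close>.
\<close>

section \<open>Chords of a regular polygon\<close>

text \<open>Twice the signed area of the triangle, positive when its corners run
  counterclockwise.\<close>

definition orient :: "complex \<Rightarrow> complex \<Rightarrow> complex \<Rightarrow> real" where
  "orient a b c = Im (cnj (b - a) * (c - a))"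

lemma right_of_iff_orient: "right_of a b c \<longleftrightarrow> orient a b c < 0"
  by (simp add: right_of_def orient_def)

lemma orient_flip: "orient b a c = - orient a b c"
  by (simp add: orient_def algebra_simps)

text \<open>The cross product of three points on the unit circle expands into a sum of three sines;
  as a product, its sign can be read off factor by factor.\<close>

lemma sin_double_add:
  fixes u v :: real
  shows "sin (2 * u) + sin (2 * v) - sin (2 * (u + v)) = 4 * sin u * sin v * sin (u + v)"
proof -
  have "sin (2 * u) = sin ((u + v) + (u - v))" "sin (2 * v) = sin ((u + v) - (u - v))"
    by simp_all
  then have "sin (2 * u) + sin (2 * v) = 2 * sin (u + v) * cos (u - v)"
    unfolding sin_add[of "u + v" "u - v"] sin_diff[of "u + v" "u - v"] by simp
  moreover have "sin (2 * (u + v)) = 2 * sin (u + v) * cos (u + v)"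
    by (rule sin_double)
  ultimately show ?thesis
    by (simp add: cos_add cos_diff algebra_simps)
qed

lemma orient_cis:
  "orient (cis \<alpha>) (cis \<beta>) (cis \<gamma>) =
    4 * sin ((\<beta> - \<alpha>) / 2) * sin ((\<gamma> - \<beta>) / 2) * sin ((\<gamma> - \<alpha>) / 2)"
proof -
  have *: "orient (cis \<alpha>) (cis \<beta>) (cis \<gamma>) = sin (\<beta> - \<alpha>) + sin (\<gamma> - \<beta>) - sin (\<gamma> - \<alpha>)"
    by (simp add: orient_def sin_diff algebra_simps)
  define u v where "u = (\<beta> - \<alpha>) / 2" and "v = (\<gamma> - \<beta>) / 2"
  have "\<beta> - \<alpha> = 2 * u" "\<gamma> - \<beta> = 2 * v" "\<gamma> - \<alpha> = 2 * (u + v)"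
    by (simp_all add: u_def v_def field_simps)
  then show ?thesis using * sin_double_add[of u v] by (simp del: distrib_left_numeral)
qed

text \<open>Two labels differ by less than \<open>2 * m\<close>, so the angle lies strictly between
  \<open>- pi\<close> and \<open>pi\<close>, where the sine has the sign of its argument.\<close>

lemma sgn_sin_diff:
  fixes i j m :: nat
  assumes "i \<in> {1..2*m}" "j \<in> {1..2*m}"
  shows "sgn (sin (pi * (real j - real i) / (2 * real m))) = sgn (real j - real i)"
proof -
  have pos: "0 < sin (pi * (real y - real x) / (2 * real m))"
    if "x < y" "x \<in> {1..2*m}" "y \<in> {1..2*m}" for x y
  proof (rule sin_gt_zero)
    show "0 < pi * (real y - real x) / (2 * real m)" using that by auto
    have "real y - real x < 2 * real m" using that by auto
    then show "pi * (real y - real x) / (2 * real m) < pi"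
      using that mult_strict_left_mono[of "real y - real x" "2 * real m" pi]
      by (simp add: pos_divide_less_eq del: mult_less_cancel_left_pos)
  qed
  have neg: "sin (pi * (real j - real i) / (2 * real m)) = - sin (pi * (real i - real j) / (2 * real m))"
    by (metis minus_diff_eq mult_minus_right minus_divide_left sin_minus)
  show ?thesis
    using pos[of i j] pos[of j i] neg assms by (cases i j rule: linorder_cases) auto
qed

text \<open>The clockwise labelling negates all three half-angles in \<open>orient_cis\<close>,
  which leaves one minus sign in front.\<close>

lemma sgn_orient_pt:
  assumes "i \<in> {1..2*m}" "j \<in> {1..2*m}" "k \<in> {1..2*m}"
  shows "sgn (orient (pt m i) (pt m j) (pt m k)) =
    - (sgn (real j - real i) * sgn (real k - real j) * sgn (real k - real i))"
proof -
  have eq: "(- (2 * pi * real y / real (2 * m)) - - (2 * pi * real x / real (2 * m))) / 2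
      = - (pi * (real y - real x) / (2 * real m))" for x y
    using assms by (simp add: field_simps)
  show ?thesis
    unfolding pt_def orient_cis eq sin_minus
    by (simp add: sgn_mult sgn_sin_diff[OF assms(1,2)] sgn_sin_diff[OF assms(2,3)]
        sgn_sin_diff[OF assms(1,3)])
qed

lemma right_of_pt_less_iff:
  assumes "i \<in> {1..2*m}" "j \<in> {1..2*m}" "k \<in> {1..2*m}" "i < j"
  shows "right_of (pt m i) (pt m j) (pt m k) \<longleftrightarrow> k < i \<or> j < k"
    and "right_of (pt m j) (pt m i) (pt m k) \<longleftrightarrow> i < k \<and> k < j"
proof -
  have 1: "right_of a b c \<longleftrightarrow> sgn (orient a b c) = -1" for a b c
    by (auto simp: right_of_iff_orient sgn_if)
  show "right_of (pt m i) (pt m j) (pt m k) \<longleftrightarrow> k < i \<or> j < k"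
    using assms(4) by (simp add: 1 sgn_orient_pt[OF assms(1-3)]) (auto simp: sgn_if)
  show "right_of (pt m j) (pt m i) (pt m k) \<longleftrightarrow> i < k \<and> k < j"
    using assms(4) by (simp add: 1 sgn_orient_pt[OF assms(2,1,3)]) (auto simp: sgn_if)
qed

text \<open>The cross product for the origin is minus the sine of the central angle
  \<open>pi * (j - i) / m\<close>, which changes sign at \<open>j - i = m\<close>.\<close>

lemma right_of_pt_0_iff:
  assumes "i \<in> {1..2*m}" "j \<in> {1..2*m}" "i < j" "j - i \<noteq> m"
  shows "right_of (pt m i) (pt m j) 0 \<longleftrightarrow> j - i < m"
    and "right_of (pt m j) (pt m i) 0 \<longleftrightarrow> m < j - i"
proof -
  have o: "orient (cis \<alpha>) (cis \<beta>) 0 = sin (\<beta> - \<alpha>)" for \<alpha> \<beta>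
    by (simp add: orient_def sin_diff algebra_simps)
  define x where "x = pi * real (j - i) / real m"
  have m: "0 < m" using assms by auto
  have "orient (pt m i) (pt m j) 0 = sin (- x)"
    unfolding pt_def o x_def using assms m by (intro arg_cong[where f = sin]) (simp add: field_simps of_nat_diff)
  then have o1: "orient (pt m i) (pt m j) 0 = - sin x" by simp
  have x: "0 < x" "x < 2 * pi"
    using assms m mult_strict_left_mono[of "real (j - i)" "2 * real m" pi]
    by (auto simp: x_def pos_divide_less_eq)
  have "0 < sin x" if "j - i < m"
  proof -
    have "x < pi"
      using that m mult_strict_left_mono[of "real (j - i)" "real m" pi]
      by (auto simp: x_def pos_divide_less_eq)
    then show ?thesis using x sin_gt_zero by blast
  qed
  moreover have "sin x < 0" if "j - i > m"
  proof -
    have "pi < x"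
      using that m mult_strict_left_mono[of "real m" "real (j - i)" pi]
      by (auto simp: x_def pos_less_divide_eq)
    then show ?thesis using x sin_lt_zero by blast
  qed
  ultimately show "right_of (pt m i) (pt m j) 0 \<longleftrightarrow> j - i < m"
    "right_of (pt m j) (pt m i) 0 \<longleftrightarrow> m < j - i"
    using assms(4) unfolding right_of_iff_orient orient_flip[of "pt m j"] o1
    by (cases "j - i < m"; force)+
qed

lemma card_eq_2_less:
  fixes e :: "nat set"
  assumes "card e = 2"
  obtains i j where "e = {i, j}" "i < j"
  using assms by (metis card_2_iff insert_commute linorder_neqE_nat)

text \<open>The four triangle areas are the coefficients of the affine dependency of four points in
  the plane.\<close>

lemma segments_meet:
  assumes "orient b c d > 0" "orient a c d > 0" "orient a b d > 0" "orient a b c > 0"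
  shows "closed_segment a c \<inter> closed_segment b d \<noteq> {}"
proof -
  define A B C D S where "A = orient b c d" and "B = orient a c d" and "C = orient a b d"
    and "D = orient a b c" and "S = A + C"
  have S: "S = B + D" "S > 0"
    using assms by (auto simp: A_def B_def C_def D_def S_def orient_def algebra_simps)
  have dep: "A *\<^sub>R a + C *\<^sub>R c = B *\<^sub>R b + D *\<^sub>R d"
    by (simp add: complex_eq_iff A_def B_def C_def D_def orient_def algebra_simps)
  \<comment> \<open>The intended common point: either side of \<open>dep\<close>, turned into a
    convex combination by \<open>S = A + C = B + D\<close>.\<close>
  define p where "p = (1 / S) *\<^sub>R (A *\<^sub>R a + C *\<^sub>R c)"
  have "p = (1 - C / S) *\<^sub>R a + (C / S) *\<^sub>R c"
    using S by (simp add: p_def S_def scaleR_add_right field_simps)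
  moreover have "p = (1 - D / S) *\<^sub>R b + (D / S) *\<^sub>R d"
    unfolding p_def dep using S by (simp add: scaleR_add_right field_simps)
  moreover have "0 \<le> C / S" "C / S \<le> 1" "0 \<le> D / S" "D / S \<le> 1"
    using S assms by (auto simp: A_def B_def C_def D_def S_def)
  ultimately have "p \<in> closed_segment a c" "p \<in> closed_segment b d"
    unfolding in_segment by blast+
  then show ?thesis by blast
qed

lemma chord_eq_segment: "chord m {i, j} = closed_segment (pt m i) (pt m j)"
  by (simp add: chord_def segment_convex_hull)

lemma interleaved_chords_meet:
  assumes "i < k" "k < j" "j < l" "{i, j, k, l} \<subseteq> {1..2*m}"
  shows "chord m {i, j} \<inter> chord m {k, l} \<noteq> {}"
proof -
  \<comment> \<open>Labels run clockwise, so descending triples are the positively oriented ones;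
    hence the order \<open>l\<close>, \<open>j\<close>, \<open>k\<close>, \<open>i\<close>
    below.\<close>
  have "sgn (orient (pt m z) (pt m y) (pt m x)) = 1"
    if "x < y" "y < z" "{x, y, z} \<subseteq> {1..2*m}" for x y z
    using sgn_orient_pt[of z m y x] that by simp
  then have pos: "orient (pt m z) (pt m y) (pt m x) > 0"
    if "x < y" "y < z" "{x, y, z} \<subseteq> {1..2*m}" for x y z
    using that by (metis zero_less_one sgn_greater)
  have "closed_segment (pt m l) (pt m k) \<inter> closed_segment (pt m j) (pt m i) \<noteq> {}"
    using assms by (intro segments_meet pos) auto
  then show ?thesis
    unfolding chord_eq_segment by (simp add: Int_commute closed_segment_commute)
qed

text \<open>An affine function vanishes on the first chord and is negative at both ends of the
  second, hence on all of it.\<close>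

lemma one_sided_chords_disjoint:
  assumes "right_of (pt m i) (pt m j) (pt m k)" "right_of (pt m i) (pt m j) (pt m l)"
  shows "chord m {i, j} \<inter> chord m {k, l} = {}"
proof -
  define L where "L = orient (pt m i) (pt m j)"
  have L: "L ((1 - u) *\<^sub>R x + u *\<^sub>R y) = (1 - u) * L x + u * L y" for u x y
    by (simp add: L_def orient_def algebra_simps)
  have "L x = 0" if x: "x \<in> chord m {i, j}" for x
  proof -
    obtain u where "x = (1 - u) *\<^sub>R pt m i + u *\<^sub>R pt m j"
      using x unfolding chord_eq_segment in_segment by blast
    moreover have "L (pt m i) = 0" "L (pt m j) = 0" by (simp_all add: L_def orient_def algebra_simps)
    ultimately show ?thesis by (simp add: L)
  qed
  moreover have "L x < 0" if x: "x \<in> chord m {k, l}" for x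
  proof -
    obtain u where x_eq: "x = (1 - u) *\<^sub>R pt m k + u *\<^sub>R pt m l" and u: "0 \<le> u" "u \<le> 1"
      using x unfolding chord_eq_segment in_segment by blast
    have neg: "L (pt m k) < 0" "L (pt m l) < 0"
      using assms by (auto simp: right_of_iff_orient L_def)
    show ?thesis
    proof (cases "u = 0")
      case False
      then have "(1 - u) * L (pt m k) \<le> 0" "u * L (pt m l) < 0"
        using u neg by (auto simp: mult_le_0_iff mult_less_0_iff)
      then show ?thesis by (simp add: x_eq L)
    qed (use neg x_eq in simp)
  qed
  ultimately show ?thesis by fastforce
qed

text \<open>Without interleaving, \<open>k\<close> and \<open>l\<close> lie on the same side of
  \<open>{i, j}\<close>; the inner side becomes the right-hand side after reversing the
  orientation.\<close>

lemma nested_or_separate_chords_disjoint: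
  assumes "{i, j, k, l} \<subseteq> {1..2*m}" "i < j" "k < l" "{i, j} \<inter> {k, l} = {}"
    and "\<not> (i < k \<and> k < j \<and> j < l)" "\<not> (k < i \<and> i < l \<and> l < j)"
  shows "chord m {i, j} \<inter> chord m {k, l} = {}"
proof -
  consider "k < i \<or> j < k" "l < i \<or> j < l" | "i < k \<and> k < j" "i < l \<and> l < j"
    using assms by fastforce
  then show ?thesis
  proof cases
    case 1
    then show ?thesis
      using assms by (intro one_sided_chords_disjoint) (auto simp: right_of_pt_less_iff)
  next
    case 2
    then have "chord m {j, i} \<inter> chord m {k, l} = {}"
      using assms by (intro one_sided_chords_disjoint) (auto simp: right_of_pt_less_iff)
    then show ?thesis by (simp add: insert_commute)
  qed
qed

section \<open>Length and sign of an edge in terms of its labels\<close>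

lemma edge_length_eq:
  assumes "i \<in> {1..2*m}" "j \<in> {1..2*m}" "i < j"
  shows "edge_length m {i, j} = min ((j - i - 1) div 2) ((2 * m - (j - i) - 1) div 2)"
proof -
  have "right_count m i j = card ({1..<i} \<union> {j<..2*m})"
    unfolding right_count_def using assms
    by (intro arg_cong[where f = card]) (auto simp: right_of_pt_less_iff)
  also have "\<dots> = 2 * m - (j - i) - 1"
    using assms by (subst card_Un_disjoint) auto
  finally have 1: "right_count m i j = 2 * m - (j - i) - 1" .
  have "right_count m j i = card {i<..<j}"
    unfolding right_count_def using assms
    by (intro arg_cong[where f = card]) (auto simp: right_of_pt_less_iff)
  then have 2: "right_count m j i = j - i - 1" by simp
  have "Min {i, j} = i" "Max {i, j} = j" using assms by auto
  then show ?thesis unfolding edge_length_def by (simp add: 1 2 min.commute)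
qed

text \<open>An odd difference is not the even number \<open>m\<close>, so exactly one endpoint
  qualifies: \<open>i\<close> for a short edge, and \<open>j\<close>, of the opposite parity, for a
  long one.\<close>

lemma edge_sign_eq:
  assumes "i \<in> {1..2*m}" "j \<in> {1..2*m}" "i < j" "odd (j - i)" "even m"
  shows "edge_sign m {i, j} = (if odd i = (j - i < m) then 1 else - 1)"
proof -
  have ne: "j - i \<noteq> m" using assms by auto
  note r = right_of_pt_0_iff[OF assms(1-3) ne]
  have "(THE x. \<exists>y. {i, j} = {x, y} \<and> right_of (pt m x) (pt m y) 0) = (if j - i < m then i else j)"
    using ne assms(3) by (intro the_equality) (auto simp: r doubleton_eq_iff)
  then show ?thesis using assms by (auto simp: edge_sign_def)
qed

section \<open>Weight of a non-crossing matching\<close>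

text \<open>One interleaving pattern suffices, since the other arises by exchanging the two
  edges.\<close>

definition noncrossing :: "nat set set \<Rightarrow> bool" where
  "noncrossing M \<longleftrightarrow> (\<forall>i j k l. {i, j} \<in> M \<and> {k, l} \<in> M \<longrightarrow> \<not> (i < k \<and> k < j \<and> j < l))"

lemma perfect_matchingD:
  assumes "perfect_matching m M"
  shows "\<Union>M = {1..2*m}" and "e \<in> M \<Longrightarrow> e \<subseteq> {1..2*m}" and "e \<in> M \<Longrightarrow> card e = 2"
    and "e \<in> M \<Longrightarrow> f \<in> M \<Longrightarrow> e \<noteq> f \<Longrightarrow> e \<inter> f = {}"
  using assms unfolding perfect_matching_def partition_on_def disjoint_def by blast+

text \<open>Chords without a common endpoint meet exactly if their endpoints interleave, so the
  geometry can be replaced by the order of the labels.\<close>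

lemma matchings_iff: "M \<in> matchings m \<longleftrightarrow> perfect_matching m M \<and> noncrossing M"
proof (cases "perfect_matching m M")
  case True
  note sub = perfect_matchingD(2)[OF True] and card = perfect_matchingD(3)[OF True]
    and disj = perfect_matchingD(4)[OF True]
  have "noncrossing M" if *: "\<forall>e\<in>M. \<forall>f\<in>M. e \<noteq> f \<longrightarrow> chord m e \<inter> chord m f = {}"
    unfolding noncrossing_def
  proof (intro allI impI notI)
    fix i j k l assume M: "{i, j} \<in> M \<and> {k, l} \<in> M" and lt: "i < k \<and> k < j \<and> j < l"
    have "{i, j, k, l} \<subseteq> {1..2*m}" using M sub[of "{i, j}"] sub[of "{k, l}"] by simp
    then have "chord m {i, j} \<inter> chord m {k, l} \<noteq> {}"
      using lt by (intro interleaved_chords_meet) auto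
    moreover have "{i, j} \<noteq> {k, l}" using lt by (simp add: doubleton_eq_iff)
    ultimately show False using * M by simp
  qed
  moreover have "chord m e \<inter> chord m f = {}"
    if nc: "noncrossing M" and ef: "e \<in> M" "f \<in> M" "e \<noteq> f" for e f
  proof -
    obtain i j where e: "e = {i, j}" "i < j" using card[OF ef(1)] by (rule card_eq_2_less)
    obtain k l where f: "f = {k, l}" "k < l" using card[OF ef(2)] by (rule card_eq_2_less)
    have eM: "{i, j} \<in> M" "{k, l} \<in> M" using ef e f by simp_all
    have "{i, j, k, l} \<subseteq> {1..2*m}" using sub[OF eM(1)] sub[OF eM(2)] by simp
    moreover have "{i, j} \<inter> {k, l} = {}" using disj[OF ef] e f by simp
    moreover have "\<not> (i < k \<and> k < j \<and> j < l)" "\<not> (k < i \<and> i < l \<and> l < j)"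
      using nc eM unfolding noncrossing_def by blast+
    ultimately show ?thesis
      using nested_or_separate_chords_disjoint[of i j k l m] e f by simp
  qed
  ultimately have "noncrossing M \<longleftrightarrow> (\<forall>e\<in>M. \<forall>f\<in>M. e \<noteq> f \<longrightarrow> chord m e \<inter> chord m f = {})"
    by blast
  then show ?thesis using True by (simp add: matchings_def)
qed (simp add: matchings_def)

lemma finite_matchings: "finite (matchings m)"
proof (rule finite_subset)
  show "matchings m \<subseteq> Pow (Pow {1..2*m})"
  proof (intro subsetI PowI)
    fix M e x assume "M \<in> matchings m" "e \<in> M" "x \<in> e"
    then show "x \<in> {1..2*m}" using perfect_matchingD(2)[of m M e] by (auto simp: matchings_iff)
  qed
qed simp

definition point_sign :: "nat \<Rightarrow> int" where
  "point_sign x = (if odd x then 1 else - 1)"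

definition long :: "nat \<Rightarrow> nat set \<Rightarrow> bool" where
  "long m e \<longleftrightarrow> m < Max e - Min e"

definition encloses :: "nat set \<Rightarrow> nat set \<Rightarrow> bool" where
  "encloses e f \<longleftrightarrow> Min e < Min f \<and> Max f < Max e"

text \<open>This, \<open>long_sum\<close> and \<open>flip_invariant\<close> are the quantities
  \<open>E\<close>, \<open>T\<close> and \<open>E - T\<close> of the overview.\<close>

definition even_starts :: "nat set set \<Rightarrow> int" where
  "even_starts M = (\<Sum>e\<in>M. of_bool (even (Min e)))"

definition long_sum :: "nat \<Rightarrow> nat set set \<Rightarrow> int" where
  "long_sum m M = (\<Sum>e\<in>M. of_bool (long m e) * point_sign (Min e))"

definition flip_invariant :: "nat \<Rightarrow> nat set set \<Rightarrow> int" where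
  "flip_invariant m M = even_starts M - long_sum m M"

lemma sum_point_sign: "(\<Sum>x\<in>{1..<k}. point_sign x) = of_bool (even k)" if "0 < k"
  using that
proof (induction k rule: nat_induct_non_zero)
  case (Suc k)
  then show ?case by (simp add: point_sign_def)
qed simp

section \<open>Counting in a fixed non-crossing matching\<close>

locale noncrossing_matching =
  fixes m :: nat and M :: "nat set set"
  assumes M: "M \<in> matchings m"
begin

lemma perfect: "perfect_matching m M"
  using M by (simp add: matchings_iff)

lemma finite_M: "finite M"
  using perfect_matchingD(1)[OF perfect] by (intro finite_UnionD) simp

lemma edge_cases:
  assumes "e \<in> M"
  obtains i j where "e = {i, j}" "i < j" "Min e = i" "Max e = j" "i \<in> {1..2*m}" "j \<in> {1..2*m}"
proof -
  have "card e = 2" "e \<subseteq> {1..2*m}"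
    using perfect_matchingD(2,3)[OF perfect assms] by simp_all
  moreover obtain i j where "e = {i, j}" "i < j" using \<open>card e = 2\<close> by (rule card_eq_2_less)
  ultimately show thesis using that[of i j] by simp
qed

lemma disjoint_edges: "e \<in> M \<Longrightarrow> f \<in> M \<Longrightarrow> e \<noteq> f \<Longrightarrow> e \<inter> f = {}"
  by (rule perfect_matchingD(4)[OF perfect])

lemma no_crossing: "{i, j} \<in> M \<Longrightarrow> {k, l} \<in> M \<Longrightarrow> \<not> (i < k \<and> k < j \<and> j < l)"
  using M unfolding matchings_iff noncrossing_def by blast

text \<open>Each point is an endpoint of exactly one edge; this turns counts of points into counts
  of edges below.\<close>

lemma sum_points: "(\<Sum>x\<in>{1..2*m}. g x) = (\<Sum>e\<in>M. g (Min e) + g (Max e))" for g :: "nat \<Rightarrow> int"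
proof -
  have "(\<Sum>x\<in>{1..2*m}. g x) = (\<Sum>x\<in>\<Union>M. g x)"
    by (simp only: perfect_matchingD(1)[OF perfect])
  also have "\<dots> = (\<Sum>e\<in>M. \<Sum>x\<in>e. g x)"
  proof (subst sum.Union_disjoint)
    show "\<forall>e\<in>M. finite e" by (auto elim!: edge_cases)
    show "\<forall>e\<in>M. \<forall>f\<in>M. e \<noteq> f \<longrightarrow> e \<inter> f = {}" using disjoint_edges by blast
  qed simp
  also have "\<dots> = (\<Sum>e\<in>M. g (Min e) + g (Max e))"
    by (intro sum.cong refl) (auto elim!: edge_cases)
  finally show ?thesis .
qed

lemma card_M: "int (card M) = int m"
  using sum_points[of "\<lambda>_. 1"] by simp

lemma edges_relation:
  assumes "e \<in> M" "f \<in> M" "f \<noteq> e"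
  shows "encloses e f \<or> encloses f e \<or> Max e < Min f \<or> Max f < Min e"
proof -
  obtain i j where e: "e = {i, j}" "i < j" "Min e = i" "Max e = j" using assms(1) by (rule edge_cases)
  obtain k l where f: "f = {k, l}" "k < l" "Min f = k" "Max f = l" using assms(2) by (rule edge_cases)
  have "{i, j} \<inter> {k, l} = {}"
    using disjoint_edges[OF assms(1,2)] assms(3) e(1) f(1) by simp
  then have "i \<noteq> k" "i \<noteq> l" "j \<noteq> k" "j \<noteq> l" by simp_all
  moreover have "\<not> (i < k \<and> k < j \<and> j < l)" "\<not> (k < i \<and> i < l \<and> l < j)"
    using no_crossing[of i j k l] no_crossing[of k l i j] assms(1,2) e(1) f(1) by simp_all
  ultimately show ?thesis
    using e(2) f(2) unfolding encloses_def e(3,4) f(3,4) by linarith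
qed

text \<open>By \<open>edges_relation\<close>, an edge with one endpoint strictly inside
  \<open>e\<close> has both there, so the points inside come in pairs.\<close>

lemma card_inside:
  assumes "e \<in> M"
  shows "int (Max e - Min e - 1) = 2 * (\<Sum>f\<in>M. of_bool (encloses e f))"
proof -
  obtain i j where e: "e = {i, j}" "i < j" "Min e = i" "Max e = j" "i \<in> {1..2*m}" "j \<in> {1..2*m}"
    using assms by (rule edge_cases)
  have "int (j - i - 1) = (\<Sum>x\<in>{i<..<j}. 1)" by simp
  also have "\<dots> = (\<Sum>x\<in>{1..2*m}. of_bool (i < x \<and> x < j))"
    using e by (intro sum.mono_neutral_cong_left) auto
  also have "\<dots> = (\<Sum>f\<in>M. of_bool (i < Min f \<and> Min f < j) + of_bool (i < Max f \<and> Max f < j))"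
    by (rule sum_points)
  also have "\<dots> = (\<Sum>f\<in>M. 2 * of_bool (encloses e f))"
  proof (intro sum.cong refl)
    fix f assume f: "f \<in> M"
    then have "Min f < Max f" by (auto elim!: edge_cases)
    then show "of_bool (i < Min f \<and> Min f < j) + of_bool (i < Max f \<and> Max f < j)
        = (2 * of_bool (encloses e f) :: int)"
      using edges_relation[OF assms f] e by (cases "f = e") (auto simp: encloses_def)
  qed
  finally show ?thesis using e by (simp add: sum_distrib_left)
qed

lemma odd_edge:
  assumes "e \<in> M"
  shows "odd (Max e - Min e)" "odd (Min e) \<longleftrightarrow> even (Max e)"
proof -
  have "even (int (Max e - Min e - 1))" using card_inside[OF assms] by simp
  moreover have lt: "Min e < Max e" using assms by (auto elim!: edge_cases)
  ultimately show "odd (Max e - Min e)" by auto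
  then show "odd (Min e) \<longleftrightarrow> even (Max e)" using lt by auto
qed

lemma sum_enclosing:
  assumes "e \<in> M"
  shows "(\<Sum>f\<in>M. of_bool (encloses f e) * point_sign (Min f)) = of_bool (even (Min e))"
proof -
  obtain i j where e: "e = {i, j}" "i < j" "Min e = i" "Max e = j" "i \<in> {1..2*m}" "j \<in> {1..2*m}"
    using assms by (rule edge_cases)
  have "of_bool (even i) = (\<Sum>x\<in>{1..<i}. point_sign x)"
    using e sum_point_sign[of i] by simp
  also have "\<dots> = (\<Sum>x\<in>{1..2*m}. of_bool (x < i) * point_sign x)"
    using e by (intro sum.mono_neutral_cong_left) auto
  also have "\<dots> = (\<Sum>f\<in>M. of_bool (Min f < i) * point_sign (Min f)
      + of_bool (Max f < i) * point_sign (Max f))"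
    by (rule sum_points)
  also have "\<dots> = (\<Sum>f\<in>M. of_bool (encloses f e) * point_sign (Min f))"
  \<comment> \<open>An edge entirely left of \<open>e\<close> cancels, its endpoints having opposite
    parity; an edge enclosing \<open>e\<close> has only its start there; all others,
    \<open>e\<close> included, have no endpoint there.\<close>
  proof (intro sum.cong refl)
    fix f assume f: "f \<in> M"
    then have "Min f < Max f" by (auto elim!: edge_cases)
    then show "of_bool (Min f < i) * point_sign (Min f) + of_bool (Max f < i) * point_sign (Max f)
        = of_bool (encloses f e) * point_sign (Min f)"
      using edges_relation[OF assms f] e odd_edge[OF f]
      by (cases "f = e") (auto simp: encloses_def point_sign_def)
  qed
  finally show ?thesis using e by simp
qed

text \<open>Both sides count nested pairs of edges with the sign of the outer one: the edges enclosing
  \<open>f\<close> contribute the alternating sum of the points left of \<open>f\<close>, as all other edges starting there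
  also end there and cancel.\<close>

lemma sum_signed_inside:
  "(\<Sum>e\<in>M. point_sign (Min e) * int ((Max e - Min e - 1) div 2)) = even_starts M"
proof -
  have "(\<Sum>e\<in>M. point_sign (Min e) * int ((Max e - Min e - 1) div 2)) =
      (\<Sum>e\<in>M. \<Sum>f\<in>M. of_bool (encloses e f) * point_sign (Min e))"
  proof (intro sum.cong refl)
    fix e assume "e \<in> M"
    from card_inside[OF this] have "int ((Max e - Min e - 1) div 2) = (\<Sum>f\<in>M. of_bool (encloses e f))"
      by (simp add: zdiv_int)
    then show "point_sign (Min e) * int ((Max e - Min e - 1) div 2) =
        (\<Sum>f\<in>M. of_bool (encloses e f) * point_sign (Min e))"
      by (simp only: sum_distrib_left mult.commute)
  qed
  also have "\<dots> = (\<Sum>f\<in>M. \<Sum>e\<in>M. of_bool (encloses e f) * point_sign (Min e))"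
    by (rule sum.swap)
  also have "\<dots> = even_starts M"
    unfolding even_starts_def by (intro sum.cong refl sum_enclosing)
  finally show ?thesis .
qed

text \<open>The long edges are the shortest long edge together with the edges enclosing it.\<close>

lemma long_sum_cases: "long_sum m M = 0 \<or> long_sum m M = 1"
proof (cases "\<exists>e\<in>M. long m e")
  case False
  then show ?thesis by (simp add: long_sum_def)
next
  case True
  then obtain e where e: "e \<in> M" "long m e"
    and min: "\<And>f. f \<in> M \<Longrightarrow> long m f \<Longrightarrow> Max e - Min e \<le> Max f - Min f"
    using ex_has_least_nat[of "\<lambda>e. e \<in> M \<and> long m e" _ "\<lambda>e. Max e - Min e"] by blast
  have lt: "Min f < Max f" "Max f \<le> 2 * m" if "f \<in> M" for f using that by (auto elim!: edge_cases)
  \<comment> \<open>Two separate long edges would need more than \<open>2 * m\<close> points, and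
    minimality keeps \<open>e\<close> from enclosing another long edge.\<close>
  have "long m f \<longleftrightarrow> f = e \<or> encloses f e" if "f \<in> M" for f
    using edges_relation[OF e(1) that] lt[OF e(1)] lt[OF that] e(2) min[OF that]
    by (cases "f = e") (auto simp: encloses_def long_def)
  moreover have "\<not> encloses e e" by (simp add: encloses_def)
  ultimately have "long_sum m M =
      (\<Sum>f\<in>M. (if f = e then point_sign (Min e) else 0) + of_bool (encloses f e) * point_sign (Min f))"
    unfolding long_sum_def by (intro sum.cong) auto
  \<comment> \<open>This is \<open>1 + 0\<close> if \<open>e\<close> starts at an odd point and
    \<open>- 1 + 1\<close> otherwise.\<close>
  also have "\<dots> = point_sign (Min e) + of_bool (even (Min e))"
    unfolding sum.distrib sum_enclosing[OF e(1)] using e finite_M by simp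
  finally show ?thesis by (auto simp: point_sign_def)
qed

text \<open>The two sides of an edge hold \<open>m - 1\<close> pairs of points together, and the
  inner side is the larger one exactly for long edges.\<close>

lemma edge_length_M:
  assumes "e \<in> M"
  shows "int (edge_length m e) = (if long m e then int m - 1 - int ((Max e - Min e - 1) div 2)
    else int ((Max e - Min e - 1) div 2))"
proof -
  obtain i j where e: "e = {i, j}" "i < j" "Min e = i" "Max e = j" "i \<in> {1..2*m}" "j \<in> {1..2*m}"
    using assms by (rule edge_cases)
  have "odd (j - i)" using odd_edge[OF assms] e by simp
  then obtain d where d: "j - i = 2 * d + 1" by (rule oddE)
  have "j - i < 2 * m" using e by auto
  then have "(2 * m - (j - i) - 1) div 2 = m - 1 - d" "d < m" by (simp_all add: d)
  then show ?thesis
    using edge_length_eq[OF e(5,6,2)] e(1-4) d by (auto simp: long_def)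
qed

context
  assumes even_m: "even m"
begin

lemma edge_sign_M:
  assumes "e \<in> M"
  shows "edge_sign m e = (if long m e then - point_sign (Min e) else point_sign (Min e))"
proof -
  obtain i j where e: "e = {i, j}" "i < j" "Min e = i" "Max e = j" "i \<in> {1..2*m}" "j \<in> {1..2*m}"
    using assms by (rule edge_cases)
  have "odd (j - i)" using odd_edge[OF assms] e by simp
  moreover from this have "j - i \<noteq> m" using even_m by auto
  ultimately show ?thesis
    using edge_sign_eq[OF e(5,6,2)] even_m e(1-4) by (auto simp: long_def point_sign_def)
qed

text \<open>For a long edge the sign is reversed and the inner count \<open>d\<close> becomes
  \<open>m - 1 - d\<close>, which amounts to the short-edge term minus
  \<open>(m - 1) * point_sign (Min e)\<close>.\<close>

lemma weight_eq: "weight m M = even_starts M - (int m - 1) * long_sum m M"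
proof -
  have "weight m M = (\<Sum>e\<in>M. point_sign (Min e) * int ((Max e - Min e - 1) div 2)
      - (int m - 1) * (of_bool (long m e) * point_sign (Min e)))"
    unfolding weight_def
    by (intro sum.cong refl) (simp add: edge_sign_M edge_length_M algebra_simps)
  also have "\<dots> = even_starts M - (int m - 1) * long_sum m M"
    unfolding sum_subtractf sum_signed_inside long_sum_def sum_distrib_left by (rule refl)
  finally show ?thesis .
qed

text \<open>As \<open>long_sum\<close> is 0 or 1, only the two weights that define one
  \<open>weight_class_plus\<close> remain.\<close>

lemma weight_eq_flip_invariant: "weight m M = flip_invariant m M - (int m - 2) * long_sum m M"
  by (simp add: weight_eq flip_invariant_def algebra_simps)

text \<open>An edge is negative exactly if it starts at an even point or is long, but not
  both.\<close>

lemma sum_edge_sign: "(\<Sum>e\<in>M. edge_sign m e) = int m - 2 * even_starts M - 2 * long_sum m M"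
proof -
  have "(\<Sum>e\<in>M. edge_sign m e) = (\<Sum>e\<in>M. 1 - 2 * of_bool (even (Min e))
      - 2 * (of_bool (long m e) * point_sign (Min e)))"
    by (intro sum.cong refl) (auto simp: edge_sign_M point_sign_def)
  also have "\<dots> = int m - 2 * even_starts M - 2 * long_sum m M"
    using card_M by (simp add: sum_subtractf even_starts_def long_sum_def flip: sum_distrib_left)
  finally show ?thesis .
qed

text \<open>The length is the smaller of two numbers with odd sum \<open>m - 1\<close>, so it stays
  at least one half below their average.\<close>

lemma edge_length_le:
  assumes "e \<in> M"
  shows "2 * int (edge_length m e) \<le> int m - 2"
proof -
  have "odd (Max e - Min e)" using odd_edge[OF assms] by simp
  moreover from this have "Max e - Min e \<noteq> m" using even_m by auto
  moreover obtain d where "Max e - Min e = 2 * d + 1" using calculation(1) by (rule oddE)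
  ultimately show ?thesis using even_m by (auto simp: edge_length_M[OF assms] long_def elim!: evenE)
qed

text \<open>Every edge of positive sign contributes at most \<open>(m - 2) / 2\<close> to the weight, and every
  edge of negative sign at least \<open>- (m - 2) / 2\<close>; a matching all but one of whose edges had the
  same sign would violate one of these bounds.\<close>

lemma flip_invariant_bounds: "0 \<le> flip_invariant m M" "flip_invariant m M \<le> int m - 2" if "0 < m"
proof -
  have sgn: "edge_sign m e = 1 \<or> edge_sign m e = - 1" for e by (simp add: edge_sign_def)
  \<comment> \<open>The factor \<open>1 + edge_sign m e\<close> is 2 or 0, so a positive edge is
    bounded by \<open>(m - 2) / 2\<close> and a negative one by 0.\<close>
  have "4 * weight m M \<le> (\<Sum>e\<in>M. (int m - 2) * (1 + edge_sign m e))"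
    unfolding weight_def sum_distrib_left
  proof (rule sum_mono)
    fix e assume "e \<in> M"
    from edge_length_le[OF this] sgn[of e]
    show "4 * (edge_sign m e * int (edge_length m e)) \<le> (int m - 2) * (1 + edge_sign m e)"
      by auto
  qed
  also have "\<dots> = (int m - 2) * (2 * int m - 2 * even_starts M - 2 * long_sum m M)"
    using card_M sum_edge_sign by (simp add: sum.distrib flip: sum_distrib_left)
  finally have upper: "4 * weight m M \<le> \<dots>" .
  have "(\<Sum>e\<in>M. - ((int m - 2) * (1 - edge_sign m e))) \<le> 4 * weight m M"
    unfolding weight_def sum_distrib_left
  proof (rule sum_mono)
    fix e assume "e \<in> M"
    from edge_length_le[OF this] sgn[of e]
    show "- ((int m - 2) * (1 - edge_sign m e)) \<le> 4 * (edge_sign m e * int (edge_length m e))"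
      by auto
  qed
  moreover have "(\<Sum>e\<in>M. - ((int m - 2) * (1 - edge_sign m e)))
      = - ((int m - 2) * (2 * even_starts M + 2 * long_sum m M))"
    using card_M sum_edge_sign by (simp add: sum_negf sum_subtractf flip: sum_distrib_left)
  ultimately have lower: "- ((int m - 2) * (2 * even_starts M + 2 * long_sum m M)) \<le> 4 * weight m M"
    by simp
  have E: "0 \<le> even_starts M" by (simp add: even_starts_def sum_nonneg)
  have m: "0 < int m" using that by simp
  have "0 \<le> flip_invariant m M \<and> flip_invariant m M \<le> int m - 2"
    using long_sum_cases
  proof
    assume 0: "long_sum m M = 0"
    \<comment> \<open>After inserting \<open>weight_eq\<close> the bound factors, and cancelling
      \<open>2 * int m\<close> leaves a bound on \<open>even_starts M\<close>.\<close>
    have "0 \<le> 2 * int m * (int m - 2 - even_starts M)"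
      using upper by (simp add: weight_eq 0 algebra_simps)
    then show ?thesis using m E by (simp add: zero_le_mult_iff flip_invariant_def 0)
  next
    assume 1: "long_sum m M = 1"
    have "0 \<le> 2 * int m * (int m - 1 - even_starts M)"
      using upper by (simp add: weight_eq 1 algebra_simps)
    moreover have "0 \<le> 2 * int m * (even_starts M - 1)"
      using lower by (simp add: weight_eq 1 algebra_simps)
    ultimately show ?thesis using m by (simp add: zero_le_mult_iff flip_invariant_def 1)
  qed
  then show "0 \<le> flip_invariant m M" "flip_invariant m M \<le> int m - 2" by simp_all
qed

end

end

section \<open>Centered flips\<close>

text \<open>The contribution of one edge to \<open>flip_invariant\<close>; a flip then only has to
  be checked on the four edges it exchanges.\<close>

definition edge_invariant :: "nat \<Rightarrow> nat set \<Rightarrow> int" where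
  "edge_invariant m e = of_bool (even (Min e)) - of_bool (long m e) * point_sign (Min e)"

lemma flip_invariant_eq_sum: "flip_invariant m M = (\<Sum>e\<in>M. edge_invariant m e)"
  by (simp only: flip_invariant_def even_starts_def long_sum_def edge_invariant_def sum_subtractf)

lemma edge_invariant_eq:
  "i < j \<Longrightarrow> edge_invariant m {i, j} = of_bool (even i) - of_bool (m < j - i) * point_sign i"
  by (simp add: edge_invariant_def long_def min_def max_def)

text \<open>The lengths sum to \<open>m - 2\<close> exactly if each of the four cyclic gaps is less than \<open>m\<close>, so
  that \<open>{p, s}\<close> is the only long side.\<close>

lemma centered_quadrilateral:
  assumes "even m" "{p, q, r, s} \<subseteq> {1..2*m}" "p < q" "q < r" "r < s"
    and "odd (q - p)" "odd (r - q)" "odd (s - r)"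
    and "edge_length m {p, q} + edge_length m {r, s} + edge_length m {p, s} + edge_length m {q, r} = m - 2"
  shows "edge_invariant m {p, q} + edge_invariant m {r, s} = edge_invariant m {p, s} + edge_invariant m {q, r}"
proof -
  obtain a where a: "q - p = 2 * a + 1" using assms(6) by (rule oddE)
  obtain b where b: "r - q = 2 * b + 1" using assms(7) by (rule oddE)
  obtain c where c: "s - r = 2 * c + 1" using assms(8) by (rule oddE)
  obtain n where n: "m = 2 * n" using assms(1) by (rule evenE)
  have q: "q = p + (2 * a + 1)" and r: "r = q + (2 * b + 1)" and s: "s = r + (2 * c + 1)"
    using a b c assms(3-5) by linarith+
  have ps: "s - p = 2 * (a + b + c + 1) + 1" by (simp add: q r s)
  have le: "a + b + c + 2 \<le> m" using ps assms(2) by auto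
  have len: "edge_length m {x, y} = min d (m - 1 - d)"
    if "x < y" "{x, y} \<subseteq> {1..2*m}" "y - x = 2 * d + 1" for x y d
  proof -
    have "(2 * m - (2 * d + 1) - 1) div 2 = m - 1 - d" by linarith
    then show ?thesis using that edge_length_eq[of x m y] by simp
  qed
  have bound: "edge_length m {x, y} \<le> d" "edge_length m {x, y} + d + 1 \<le> m"
    if "x < y" "{x, y} \<subseteq> {1..2*m}" "y - x = 2 * d + 1" "d < m" for x y d
    using len[OF that(1-3)] that(4) by simp_all
  have "edge_length m {p, q} + edge_length m {r, s} + edge_length m {p, s} + edge_length m {q, r} + 2 = m"
    using assms(9) le by simp
  moreover have "edge_length m {p, q} \<le> a" "edge_length m {p, q} + a + 1 \<le> m"
    by (rule bound; use assms(2,3) a le in simp)+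
  moreover have "edge_length m {q, r} \<le> b" "edge_length m {q, r} + b + 1 \<le> m"
    by (rule bound; use assms(2,4) b le in simp)+
  moreover have "edge_length m {r, s} \<le> c" "edge_length m {r, s} + c + 1 \<le> m"
    by (rule bound; use assms(2,5) c le in simp)+
  moreover have "edge_length m {p, s} \<le> a + b + c + 1" "edge_length m {p, s} + (a + b + c + 1) + 1 \<le> m"
    by (rule bound; use assms(2-5) ps le in simp)+
  \<comment> \<open>If \<open>a \<ge> n\<close>, the lengths sum to at most
    \<open>2 * m - 3 - 2 * a < m - 2\<close>, and likewise for \<open>b\<close> and
    \<open>c\<close>; if \<open>a + b + c + 1 < n\<close>, to at most
    \<open>2 * (a + b + c) + 1 < m - 2\<close>.\<close>
  ultimately have "a < n" "b < n" "c < n" "n \<le> a + b + c + 1"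
    using n by linarith+
  then have "q - p < m" "r - q < m" "s - r < m" "m < s - p"
    unfolding a b c ps by (simp_all add: n)
  moreover have "even q \<longleftrightarrow> odd p" "even r \<longleftrightarrow> even p" by (simp_all add: q r)
  moreover have "p < s" using assms by simp
  \<comment> \<open>Both sides are 2 for even \<open>p\<close> and 0 for odd \<open>p\<close>: on
    the right, the starts \<open>p\<close> and \<open>q\<close> give 1 and the long edge gives
    \<open>- point_sign p\<close>.\<close>
  ultimately show ?thesis
    using assms(3-5) by (simp add: edge_invariant_eq point_sign_def)
qed

text \<open>These relabellings can move any of the four points to the first position, so that it may
  be assumed to be the least.\<close>

lemma flips_to_swap:
  assumes "flips_to M a b c d M'"
  shows "flips_to M b a d c M'" "flips_to M c d a b M'" "flips_to M d c b a M'"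
  using assms unfolding flips_to_def by (auto simp: insert_commute)

lemma centered_swap:
  assumes "centered m a b c d"
  shows "centered m b a d c" "centered m c d a b" "centered m d c b a"
  using assms unfolding centered_def by (simp_all add: insert_commute)

lemma flip_points_distinct:
  assumes "M \<in> matchings m" "M' \<in> matchings m" "flips_to M a b c d M'"
  shows "distinct [a, b, c, d]"
proof -
  interpret A: noncrossing_matching m M by unfold_locales fact
  have ab: "{a, b} \<in> M" "{c, d} \<in> M" "{a, b} \<noteq> {c, d}"
    using assms(3) by (auto simp: flips_to_def)
  have "card {a, b} = 2" "card {c, d} = 2" using perfect_matchingD(3)[OF A.perfect] ab by blast+
  then have "a \<noteq> b" "c \<noteq> d" by auto
  then show ?thesis using A.disjoint_edges[OF ab] by auto
qed

lemma centered_flip_edge_invariant_aux: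
  assumes "M \<in> matchings m" "M' \<in> matchings m" "even m"
    and flip: "flips_to M a b c d M'" and cen: "centered m a b c d"
    and lt: "a < b" "a < c" "a < d"
  shows "edge_invariant m {a, b} + edge_invariant m {c, d} = edge_invariant m {a, c} + edge_invariant m {b, d}"
proof -
  interpret A: noncrossing_matching m M by unfold_locales fact
  interpret B: noncrossing_matching m M' by unfold_locales fact
  have M: "{a, b} \<in> M" "{c, d} \<in> M" and M': "{a, c} \<in> M'" "{b, d} \<in> M'"
    using flip by (auto simp: flips_to_def)
  have sub: "{a, b} \<subseteq> {1..2*m}" "{c, d} \<subseteq> {1..2*m}"
    using perfect_matchingD(2)[OF A.perfect] M by blast+
  have A_odd: "odd (y - x)" if "{x, y} \<in> M" "x < y" for x y
    using A.odd_edge(1)[OF that(1)] that(2) by simp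
  have B_odd: "odd (y - x)" if "{x, y} \<in> M'" "x < y" for x y
    using B.odd_edge(1)[OF that(1)] that(2) by simp
  have dist: "distinct [a, b, c, d]" using assms(1,2) flip by (rule flip_points_distinct)
  have MM: "{d, c} \<in> M" "{d, b} \<in> M'" using M M' by (simp_all add: insert_commute)
  have nA: "\<not> (a < c \<and> c < b \<and> b < d)" "\<not> (a < d \<and> d < b \<and> b < c)"
    by (rule A.no_crossing[OF M] A.no_crossing[OF M(1) MM(1)])+
  have nB: "\<not> (a < b \<and> b < c \<and> c < d)" "\<not> (a < d \<and> d < c \<and> c < b)"
    by (rule B.no_crossing[OF M'] B.no_crossing[OF M'(1) MM(2)])+
  \<comment> \<open>Four of the six orders of \<open>b\<close>, \<open>c\<close>, \<open>d\<close>
    make the removed or the added edges interleave; in the other two, \<open>d\<close> lies between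
    \<open>b\<close> and \<open>c\<close>. They are treated as mutually inverse exchanges.\<close>
  consider "b < d" "d < c" | "c < d" "d < b"
    using nA nB lt dist by (metis distinct_length_2_or_more linorder_neqE_nat)
  then show ?thesis
  proof cases
    case 1
    then have "edge_invariant m {a, b} + edge_invariant m {d, c} = edge_invariant m {a, c} + edge_invariant m {b, d}"
      using assms(3) sub lt A_odd[OF M(1)] B_odd[OF M'(2)] A_odd[OF MM(1)] cen
      by (intro centered_quadrilateral) (auto simp: centered_def insert_commute)
    then show ?thesis by (simp add: insert_commute)
  next
    case 2
    then have "edge_invariant m {a, c} + edge_invariant m {d, b} = edge_invariant m {a, b} + edge_invariant m {c, d}"
      using assms(3) sub lt B_odd[OF M'(1)] A_odd[OF M(2)] B_odd[OF MM(2)] cen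
      by (intro centered_quadrilateral) (auto simp: centered_def insert_commute)
    then show ?thesis by (simp add: insert_commute)
  qed
qed

lemma centered_flip_edge_invariant:
  assumes "M \<in> matchings m" "M' \<in> matchings m" "even m"
    and flip: "flips_to M a b c d M'" and cen: "centered m a b c d"
  shows "edge_invariant m {a, b} + edge_invariant m {c, d} = edge_invariant m {a, c} + edge_invariant m {b, d}"
proof -
  note aux = centered_flip_edge_invariant_aux[OF assms(1-3)]
  note sw = flips_to_swap[OF flip] and csw = centered_swap[OF cen]
  have dist: "distinct [a, b, c, d]" using assms(1,2) flip by (rule flip_points_distinct)
  consider "a < b" "a < c" "a < d" | "b < a" "b < d" "b < c" | "c < d" "c < a" "c < b"
    | "d < c" "d < b" "d < a"
    using dist by fastforce
  then show ?thesis
  proof cases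
    case 1
    then show ?thesis using aux[OF flip cen] by simp
  next
    case 2
    then show ?thesis using aux[OF sw(1) csw(1)] by (simp add: insert_commute)
  next
    case 3
    then show ?thesis using aux[OF sw(2) csw(2)] by (simp add: insert_commute)
  next
    case 4
    then show ?thesis using aux[OF sw(3) csw(3)] by (simp add: insert_commute)
  qed
qed

lemma centered_flip_invariant:
  assumes "M \<in> matchings m" "M' \<in> matchings m" "even m"
    and flip: "flips_to M a b c d M'" and cen: "centered m a b c d"
  shows "flip_invariant m M = flip_invariant m M'"
proof -
  interpret A: noncrossing_matching m M by unfold_locales fact
  define R where "R = M - {{a, b}, {c, d}}"
  have ab: "{a, b} \<in> M" "{c, d} \<in> M" "{a, b} \<noteq> {c, d}" and M': "M' = R \<union> {{a, c}, {b, d}}"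
    using flip by (auto simp: flips_to_def R_def)
  have M: "M = R \<union> {{a, b}, {c, d}}" using ab by (auto simp: R_def)
  have dist: "a \<noteq> b" "a \<noteq> c" "a \<noteq> d" "b \<noteq> c" "b \<noteq> d" "c \<noteq> d"
    using flip_points_distinct[OF assms(1,2) flip] by auto
  have fin: "finite R" using A.finite_M by (simp add: R_def)
  \<comment> \<open>An added edge shares just one endpoint with \<open>{a, b}\<close>, so it cannot
    lie in \<open>M\<close>, and the sums below split over disjoint sets.\<close>
  have "{a, c} \<notin> M"
    using A.disjoint_edges[OF ab(1), of "{a, c}"] dist by (auto simp: doubleton_eq_iff)
  moreover have "{b, d} \<notin> M"
    using A.disjoint_edges[OF ab(1), of "{b, d}"] dist by (auto simp: doubleton_eq_iff)
  ultimately have "R \<inter> {{a, c}, {b, d}} = {}" by (simp add: R_def)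
  moreover have "{a, c} \<noteq> {b, d}" using dist by (simp add: doubleton_eq_iff)
  ultimately have "flip_invariant m M' = sum (edge_invariant m) R + (edge_invariant m {a, c} + edge_invariant m {b, d})"
    unfolding flip_invariant_eq_sum M' using fin by (simp add: sum.union_disjoint)
  moreover have "R \<inter> {{a, b}, {c, d}} = {}" by (simp add: R_def)
  then have "flip_invariant m M = sum (edge_invariant m) R + (edge_invariant m {a, b} + edge_invariant m {c, d})"
    unfolding flip_invariant_eq_sum using fin ab(3) by (subst M) (simp add: sum.union_disjoint)
  ultimately show ?thesis using centered_flip_edge_invariant[OF assms] by simp
qed

section \<open>Matchings attaining every value of the invariant\<close>

definition umbrella :: "nat \<Rightarrow> nat \<Rightarrow> nat set set" where
  "umbrella m c = insert {1, 2 * c + 2}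
     ((\<lambda>i. {2 * i, 2 * i + 1}) ` {1..c} \<union> (\<lambda>i. {2 * i + 1, 2 * i + 2}) ` {c + 1..<m})"

text \<open>With \<open>c\<close> edges below \<open>{1, 2c + 2}\<close> the invariant is \<open>c\<close> as long as that edge is short, and
  \<open>c - 1\<close> otherwise; together these values exhaust \<open>0, \<dots>, m - 2\<close>.\<close>

lemma umbrella_cases:
  assumes "e \<in> umbrella m c"
  obtains "e = {1, 2 * c + 2}"
  | i where "e = {2 * i, 2 * i + 1}" "1 \<le> i" "i \<le> c"
  | i where "e = {2 * i + 1, 2 * i + 2}" "c < i" "i < m"
  using assms by (auto simp: umbrella_def)

lemma umbrella_in_matchings:
  assumes "c < m"
  shows "umbrella m c \<in> matchings m"
proof -
  have "\<Union>(umbrella m c) = {1..2*m}"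
  proof (intro equalityI subsetI)
    fix x assume "x \<in> \<Union>(umbrella m c)"
    then obtain e where "e \<in> umbrella m c" "x \<in> e" by blast
    from this(1) this(2) assms show "x \<in> {1..2*m}" by (cases rule: umbrella_cases) auto
  next
    fix x assume x: "x \<in> {1..2*m}"
    show "x \<in> \<Union>(umbrella m c)"
    proof (cases "x = 1 \<or> x = 2 * c + 2")
      case True
      then show ?thesis by (auto simp: umbrella_def)
    next
      case False
      show ?thesis
      proof (cases "x \<le> 2 * c + 1")
        case True
        then have "x div 2 \<in> {1..c}" "x \<in> {2 * (x div 2), 2 * (x div 2) + 1}"
          using x False by auto
        then show ?thesis unfolding umbrella_def by blast
      next
        case 2: False
        then have "(x - 1) div 2 \<in> {c + 1..<m}" "x \<in> {2 * ((x - 1) div 2) + 1, 2 * ((x - 1) div 2) + 2}"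
          using x False by auto
        then show ?thesis unfolding umbrella_def by blast
      qed
    qed
  qed
  \<comment> \<open>The edge through \<open>x\<close> is computed from \<open>x\<close> alone, which
    yields disjointness without comparing the kinds of edges pairwise.\<close>
  moreover have uniq: "e = (if x = 1 \<or> x = 2 * c + 2 then {1, 2 * c + 2}
      else if x \<le> 2 * c + 1 then {2 * (x div 2), 2 * (x div 2) + 1}
      else {2 * ((x - 1) div 2) + 1, 2 * ((x - 1) div 2) + 2})"
    if e: "e \<in> umbrella m c" and x: "x \<in> e" for e x
    using e
  proof (cases rule: umbrella_cases)
    case 1
    then show ?thesis using x by simp
  next
    case (2 i)
    have "x = 2 * i \<or> x = 2 * i + 1" using x 2(1) by simp
    then have "x \<noteq> 1" "x \<noteq> 2 * c + 2" "x \<le> 2 * c + 1" "x div 2 = i"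
      using 2(2,3) by linarith+
    then show ?thesis using 2 by simp
  next
    case (3 i)
    have "x = 2 * i + 1 \<or> x = 2 * i + 2" using x 3(1) by simp
    then have "x \<noteq> 1" "x \<noteq> 2 * c + 2" "\<not> x \<le> 2 * c + 1" "(x - 1) div 2 = i"
      using 3(2,3) by linarith+
    then show ?thesis using 3 by simp
  qed
  have "e \<inter> f = {}" if ef: "e \<in> umbrella m c" "f \<in> umbrella m c" "e \<noteq> f" for e f
  proof (rule equals0I)
    fix x assume "x \<in> e \<inter> f"
    then have "x \<in> e" "x \<in> f" by simp_all
    then have "e = f" by (rule trans[OF uniq[OF ef(1)] uniq[OF ef(2), symmetric]])
    then show False using ef(3) by simp
  qed
  moreover have card: "card e = 2" if "e \<in> umbrella m c" for e
    using that by (cases rule: umbrella_cases) auto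
  moreover have "{} \<notin> umbrella m c" using card by fastforce
  ultimately have "perfect_matching m (umbrella m c)"
    by (auto simp: perfect_matching_def partition_on_def disjoint_def)
  \<comment> \<open>Consecutive points have nothing between them, so \<open>{i, j}\<close> must be
    \<open>{1, 2 * c + 2}\<close>; an edge crossing it would have to jump over
    \<open>2 * c + 2\<close>.\<close>
  moreover have "\<not> (i < k \<and> k < j \<and> j < l)" if "{i, j} \<in> umbrella m c" "{k, l} \<in> umbrella m c" for i j k l
    using that(1)
  proof (cases rule: umbrella_cases)
    case 1
    from that(2) show ?thesis by (cases rule: umbrella_cases) (use 1 in \<open>auto simp: doubleton_eq_iff\<close>)
  qed (auto simp: doubleton_eq_iff)
  ultimately show ?thesis by (auto simp: matchings_iff noncrossing_def)
qed

lemma flip_invariant_umbrella: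
  assumes "c < m" "2 \<le> m"
  shows "flip_invariant m (umbrella m c) = int c - of_bool (m < 2 * c + 1)"
proof -
  let ?A = "(\<lambda>i. {2 * i, 2 * i + 1}) ` {1..c}" and ?B = "(\<lambda>i. {2 * i + 1, 2 * i + 2}) ` {c + 1..<m}"
  have A: "inj_on (\<lambda>i::nat. {2 * i, 2 * i + 1}) {1..c}"
    and B: "inj_on (\<lambda>i::nat. {2 * i + 1, 2 * i + 2}) {c + 1..<m}"
    by (auto simp: inj_on_def doubleton_eq_iff)
  have "?A \<inter> ?B = {}"
  proof (rule equals0I)
    fix e assume "e \<in> ?A \<inter> ?B"
    then obtain i k where ik: "e = {2 * i, 2 * i + 1}" "i \<in> {1..c}"
      "e = {2 * k + 1, 2 * k + 2}" "k \<in> {c + 1..<m}"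
      by blast
    then have "2 * i \<in> {2 * k + 1, 2 * k + 2}" by (metis insertI1)
    then show False using ik(2,4) by simp
  qed
  moreover have "{1, 2 * c + 2} \<notin> ?A \<union> ?B"
  proof -
    have "1 \<notin> {2 * i, 2 * i + 1}" if "i \<in> {1..c}" for i using that by simp
    moreover have "1 \<notin> {2 * i + 1, 2 * i + 2}" if "i \<in> {c + 1..<m}" for i using that by simp
    ultimately show ?thesis by blast
  qed
  ultimately have "flip_invariant m (umbrella m c) = edge_invariant m {1, 2 * c + 2}
      + (sum (edge_invariant m) ?A + sum (edge_invariant m) ?B)"
    unfolding flip_invariant_eq_sum umbrella_def by (simp add: sum.union_disjoint)
  \<comment> \<open>The \<open>c\<close> edges of \<open>?A\<close> start at even points and give 1
    each, those of \<open>?B\<close> start at odd points and give 0, and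
    \<open>{1, 2 * c + 2}\<close> gives -1 if it is long.\<close>
  also have "\<dots> = int c - of_bool (m < 2 * c + 1)"
    unfolding sum.reindex[OF A] sum.reindex[OF B] o_def
    using assms by (simp add: edge_invariant_eq point_sign_def)
  finally show ?thesis .
qed

lemma ex_matching_flip_invariant:
  assumes "even m" "2 \<le> m" "c \<in> {0..int m - 2}"
  obtains M where "M \<in> matchings m" "flip_invariant m M = c"
proof (cases "2 * c + 1 \<le> int m")
  case True
  then show thesis
    using that[of "umbrella m (nat c)"] assms umbrella_in_matchings[of "nat c" m] flip_invariant_umbrella[of "nat c" m]
    by auto
next
  \<comment> \<open>The outer edge is long here, so one more edge below it makes up for its
    contribution -1; \<open>c \<le> int m - 2\<close> keeps \<open>nat c + 1\<close> below
    \<open>m\<close>.\<close>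
  case False
  then show thesis
    using that[of "umbrella m (nat c + 1)"] assms umbrella_in_matchings[of "nat c + 1" m]
      flip_invariant_umbrella[of "nat c + 1" m]
    by auto
qed

section \<open>Connected components and the final count\<close>

text \<open>Vertices of one component are joined by a path of arcs taken in either direction, along
  which a function preserved by arcs stays constant.\<close>

lemma components_verts_props:
  assumes "pair_wf_digraph G"
  shows ex_component: "u \<in> pverts G \<Longrightarrow> \<exists>K\<in>components_verts G. u \<in> K"
    and component_subset: "K \<in> components_verts G \<Longrightarrow> K \<subseteq> pverts G"
    and component_nonempty: "K \<in> components_verts G \<Longrightarrow> K \<noteq> {}"
    and component_invariant: "(\<And>u v. (u, v) \<in> parcs G \<Longrightarrow> f u = f v) \<Longrightarrow>
      K \<in> components_verts G \<Longrightarrow> u \<in> K \<Longrightarrow> v \<in> K \<Longrightarrow> f u = f v"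
proof -
  interpret G: pair_wf_digraph G by fact
  interpret S: pair_wf_digraph "mk_symmetric (with_proj G)" by (rule G.wellformed_mk_symmetric)
  show "\<exists>K\<in>components_verts G. u \<in> K" if "u \<in> pverts G"
    using that S.scc_of_in_sccs_verts[of u] S.in_scc_of_self[of u]
    unfolding components_verts_def by auto
  show "K \<subseteq> pverts G" if "K \<in> components_verts G"
    using that S.sccs_verts_subsets[of K] unfolding components_verts_def by simp
  show "K \<noteq> {}" if "K \<in> components_verts G"
    using that unfolding components_verts_def S.in_sccs_verts_conv_reachable by simp
  show "f u = f v" if f: "\<And>u v. (u, v) \<in> parcs G \<Longrightarrow> f u = f v"
    and "K \<in> components_verts G" "u \<in> K" "v \<in> K"
  proof -
    have "u \<rightarrow>\<^sup>*\<^bsub>with_proj (mk_symmetric (with_proj G))\<^esub> v"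
      using that unfolding components_verts_def S.in_sccs_verts_conv_reachable by blast
    then show ?thesis
    proof (induction rule: S.reachable_induct)
      case (step x y)
      then have "f x = f y" using f by (auto simp: parcs_mk_symmetric)
      then show ?case using step by simp
    qed simp
  qed
qed

lemma centered_flip_graph_wf: "pair_wf_digraph (centered_flip_graph m)"
  by unfold_locales (auto simp: centered_flip_graph_def flip_graph_def)

lemma pverts_centered_flip_graph: "pverts (centered_flip_graph m) = matchings m"
  by (simp add: centered_flip_graph_def flip_graph_def)

lemma flip_invariant_arc:
  assumes "even m" "(M, M') \<in> parcs (centered_flip_graph m)"
  shows "M \<in> matchings m" "M' \<in> matchings m" "flip_invariant m M = flip_invariant m M'"
proof -
  show "M \<in> matchings m" "M' \<in> matchings m"
    using assms by (auto simp: centered_flip_graph_def flip_graph_def)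
  moreover obtain a b c d where "flips_to M a b c d M'" "centered m a b c d"
    using assms by (auto simp: centered_flip_graph_def)
  ultimately show "flip_invariant m M = flip_invariant m M'"
    using centered_flip_invariant assms(1) by blast
qed

lemma weight_cases:
  assumes "even m" "M \<in> matchings m"
  shows "weight m M = flip_invariant m M \<or> weight m M = flip_invariant m M - (int m - 2)"
proof -
  interpret noncrossing_matching m M by unfold_locales fact
  show ?thesis using weight_eq_flip_invariant[OF assms(1)] long_sum_cases by auto
qed

lemma in_weight_class_plus:
  assumes "even m" "M \<in> matchings m"
  shows "M \<in> weight_class_plus m (flip_invariant m M)"
  using weight_cases[OF assms] assms(2) by (auto simp: weight_class_plus_def weight_class_def)

lemma flip_invariant_range:
  assumes "even m" "2 \<le> m" "M \<in> matchings m"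
  shows "flip_invariant m M \<in> {0..int m - 2}"
proof -
  interpret noncrossing_matching m M by unfold_locales fact
  show ?thesis using flip_invariant_bounds[OF assms(1)] assms(2) by simp
qed

text \<open>The first conjunct uses set differences because the classes for \<open>0\<close> and
  \<open>m - 2\<close> overlap, and an arc within the overlap does not lead from one class to
  another.\<close>

theorem theorem13:
  fixes m :: nat
  assumes "even m" and "m \<ge> 2"
  shows "(\<forall>c\<in>{0..int m - 2}. \<forall>c'\<in>{0..int m - 2}. c \<noteq> c' \<longrightarrow>
            \<not> (\<exists>(M, M')\<in>parcs (centered_flip_graph m).
                 M \<in> weight_class_plus m c - weight_class_plus m c' \<and>
                 M' \<in> weight_class_plus m c' - weight_class_plus m c)) \<and>
         (\<forall>K\<in>components_verts (centered_flip_graph m).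
            \<exists>c\<in>{0..int m - 2}. K \<subseteq> weight_class_plus m c) \<and>
         (\<forall>c\<in>{0..int m - 2}.
            \<exists>K\<in>components_verts (centered_flip_graph m). K \<subseteq> weight_class_plus m c) \<and>
         card (components_verts (centered_flip_graph m)) \<ge> m - 1"
proof (intro conjI ballI impI notI)
  fix c c' assume c: "c \<in> {0..int m - 2}" "c' \<in> {0..int m - 2}" "c \<noteq> c'"
    and "\<exists>(M, M')\<in>parcs (centered_flip_graph m).
                 M \<in> weight_class_plus m c - weight_class_plus m c' \<and>
                 M' \<in> weight_class_plus m c' - weight_class_plus m c"
  then obtain M M' where arc: "(M, M') \<in> parcs (centered_flip_graph m)"
    and M: "M \<in> weight_class_plus m c" "M \<notin> weight_class_plus m c'"
    and M': "M' \<in> weight_class_plus m c'" "M' \<notin> weight_class_plus m c"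
    by blast
  note arc = flip_invariant_arc[OF assms(1) arc]
  define I where "I = flip_invariant m M"
  have "I \<noteq> c'" using M in_weight_class_plus[OF assms(1) arc(1)] by (auto simp: I_def)
  moreover have "I \<noteq> c" using M' in_weight_class_plus[OF assms(1) arc(2)] arc(3) by (auto simp: I_def)
  moreover have "0 \<le> I" "I \<le> int m - 2" using flip_invariant_range[OF assms arc(1)] by (auto simp: I_def)
  moreover have "weight m M = I \<or> weight m M = I - (int m - 2)"
    "weight m M' = I \<or> weight m M' = I - (int m - 2)"
    using weight_cases[OF assms(1) arc(1)] weight_cases[OF assms(1) arc(2)] arc(3)
    by (simp_all add: I_def)
  moreover have "weight m M = c \<or> weight m M = c - (int m - 2)"
    "weight m M' = c' \<or> weight m M' = c' - (int m - 2)"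
    using M(1) M'(1) by (auto simp: weight_class_plus_def weight_class_def)
  \<comment> \<open>Distinct \<open>I\<close> and \<open>c\<close> admit a common weight only if one
    is 0 and the other \<open>m - 2\<close>; the same for \<open>I\<close> and \<open>c'\<close>
    forces \<open>c = c'\<close>.\<close>
  ultimately show False using c unfolding atLeastAtMost_iff by linarith
next
  let ?G = "centered_flip_graph m"
  note wf = centered_flip_graph_wf[of m]
  have const: "flip_invariant m M = flip_invariant m M'"
    if "K \<in> components_verts ?G" "M \<in> K" "M' \<in> K" for K M M'
    using component_invariant[OF wf flip_invariant_arc(3)[OF assms(1)] that] .
  have sub: "K \<subseteq> matchings m" if "K \<in> components_verts ?G" for K
    using component_subset[OF wf that] by (simp add: pverts_centered_flip_graph)
  have in_class: "K \<subseteq> weight_class_plus m (flip_invariant m M)"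
    if "K \<in> components_verts ?G" "M \<in> K" for K M
    using const[OF that] sub[OF that(1)] in_weight_class_plus[OF assms(1)] by fastforce
  have ex: "\<exists>K. K \<in> components_verts ?G \<and> (\<exists>M\<in>K. flip_invariant m M = c)"
    if c: "c \<in> {0..int m - 2}" for c
  proof -
    obtain M where "M \<in> matchings m" "flip_invariant m M = c"
      using ex_matching_flip_invariant[OF assms c] .
    then show ?thesis using ex_component[OF wf, of M] by (auto simp: pverts_centered_flip_graph)
  qed
  show "\<exists>c\<in>{0..int m - 2}. K \<subseteq> weight_class_plus m c" if K: "K \<in> components_verts ?G" for K
  proof -
    obtain M where "M \<in> K" using component_nonempty[OF wf K] by blast
    then show ?thesis using in_class[OF K] flip_invariant_range[OF assms] sub[OF K] by blast
  qed
  show "\<exists>K\<in>components_verts ?G. K \<subseteq> weight_class_plus m c" if "c \<in> {0..int m - 2}" for c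
    using ex[OF that] in_class by blast
  \<comment> \<open>Components are counted by values of the invariant, which separate them, and not
    by the overlapping classes.\<close>
  obtain comp where comp: "\<And>c. c \<in> {0..int m - 2} \<Longrightarrow>
      comp c \<in> components_verts ?G \<and> (\<exists>M\<in>comp c. flip_invariant m M = c)"
    using ex by metis
  have "inj_on comp {0..int m - 2}"
  proof (rule inj_onI)
    fix c c' assume "c \<in> {0..int m - 2}" "c' \<in> {0..int m - 2}" "comp c = comp c'"
    then show "c = c'" using comp[of c] comp[of c'] const by metis
  qed
  moreover have "finite (components_verts ?G)"
    by (rule finite_subset[of _ "Pow (matchings m)"]) (use sub finite_matchings in auto)
  ultimately have "card {0..int m - 2} \<le> card (components_verts ?G)"
    using comp by (intro card_inj_on_le[of comp]) auto
  then show "m - 1 \<le> card (components_verts ?G)" using assms(2) by simp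
qed

end
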